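(* For all positive integers $k,n$ and every integer $r\geq 1$, $$\sigma^{(k)}_r\mathrm{mex}(n)=\sum_{m\geq 0}\big[(m+1)^k-m^k\big]\,p\big(n-t_r(m)\big)$$ and $$\overline{\sigma}^{(k)}_r\mathrm{mex}(n)=\sum_{m\geq 0}(-1)^m\big[(m+1)^k+m^k\big]\,p\big(n-t_r(m)\big).$$
   Context: For an integer $n\ge 0$, $p(n)$ denotes the number of partitions of $n$, with $p(0)=1$ and $p(n)=0$ for $n<0$; $\mathcal{P}(n)$ is the set of all partitions of $n$. For an integer $r\geq 1$ and a partition $\pi$, $r\text{-}\mathrm{mex}(\pi)$ (the least $r$-gap) is the least positive integer that does not occur at least $r$ times as a part of $\pi$. Define $$\sigma^{(k)}_r\mathrm{mex}(n):=\sum_{\pi\in\mathcal{P}(n)}\big(r\text{-}\mathrm{mex}(\pi)\big)^k,\qquad \overline{\sigma}^{(k)}_r\mathrm{mex}(n):=\sum_{\pi\in\mathcal{P}(n)}(-1)^{r\text{-}\mathrm{mex}(\pi)-1}\big(r\text{-}\mathrm{mex}(\pi)\big)^k.$$ For $m\geq 0$, $t_r(m):=r\cdot\frac{m(m+1)}{2}$. All sums are finite (only finitely many nonzero terms). *)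

theory Defs
  imports Main "HOL-Library.Multiset" "HOL-Library.Groups_Big_Fun"
begin

definition partitions :: "nat \<Rightarrow> nat multiset set" where
  "partitions n = {\<pi>. 0 \<notin># \<pi> \<and> sum_mset \<pi> = n}"

definition num_partitions :: "int \<Rightarrow> nat" where
  "num_partitions n = (if n < 0 then 0 else card (partitions (nat n)))"

definition rmex :: "nat \<Rightarrow> nat multiset \<Rightarrow> nat" where
  "rmex r \<pi> = (LEAST i. 0 < i \<and> \<not> r \<le> count \<pi> i)"

definition sigma_rmex :: "nat \<Rightarrow> nat \<Rightarrow> nat \<Rightarrow> int" where
  "sigma_rmex k r n = (\<Sum>\<pi>\<in>partitions n. int (rmex r \<pi>) ^ k)"

(* For r \<ge> 1 we have rmex r \<pi> \<ge> 1, so the exponent is not truncated. *)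
definition sigma_bar_rmex :: "nat \<Rightarrow> nat \<Rightarrow> nat \<Rightarrow> int" where
  "sigma_bar_rmex k r n =
     (\<Sum>\<pi>\<in>partitions n. (- 1) ^ (rmex r \<pi> - 1) * int (rmex r \<pi>) ^ k)"

definition tri :: "nat \<Rightarrow> nat \<Rightarrow> nat" where
  "tri r m = r * (m * (m + 1) div 2)"

(* The next two lemmas rule out the junk values of LEAST, sum and card. *)
lemma rmex_properties:
  assumes "1 \<le> r"
  shows "0 < rmex r \<pi>" and "\<not> r \<le> count \<pi> (rmex r \<pi>)"
    and "\<And>i. \<lbrakk>0 < i; i < rmex r \<pi>\<rbrakk> \<Longrightarrow> r \<le> count \<pi> i"
proof -
  obtain i where "i \<notin> insert 0 (set_mset \<pi>)"
    using ex_new_if_finite[of "insert 0 (set_mset \<pi>)"] by auto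
  with assms have ex: "0 < i \<and> \<not> r \<le> count \<pi> i"
    by (auto simp: not_in_iff)
  from LeastI[of "\<lambda>i. 0 < i \<and> \<not> r \<le> count \<pi> i", OF ex]
  show "0 < rmex r \<pi>" and "\<not> r \<le> count \<pi> (rmex r \<pi>)"
    by (simp_all add: rmex_def)
  show "r \<le> count \<pi> i" if "0 < i" "i < rmex r \<pi>" for i
    using not_less_Least[of i "\<lambda>i. 0 < i \<and> \<not> r \<le> count \<pi> i"] that
    by (simp add: rmex_def)
qed

lemma finite_partitions: "finite (partitions n)"
proof (rule finite_subset)
  show "partitions n \<subseteq> mset ` {xs. set xs \<subseteq> {..n} \<and> length xs \<le> n}"
  proof
    fix \<pi> assume \<pi>: "\<pi> \<in> partitions n"
    obtain xs where xs: "mset xs = \<pi>" using ex_mset by blast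
    with \<pi> have pos: "0 \<notin> set xs" and sum: "sum_list xs = n"
      by (auto simp: partitions_def sum_mset_sum_list)
    have "length xs \<le> sum_list xs" using pos by (induction xs) auto
    moreover have "set xs \<subseteq> {..n}"
      using member_le_sum_list sum by fastforce
    ultimately show "\<pi> \<in> mset ` {xs. set xs \<subseteq> {..n} \<and> length xs \<le> n}"
      using xs sum by blast
  qed
  show "finite (mset ` {xs. set xs \<subseteq> {..n} \<and> length xs \<le> n})"
    by (simp add: finite_lists_length_le)
qed

(* Sum_any is 0 on functions of infinite support; here the support is finite. *)
lemma finite_support_num_partitions:
  assumes "1 \<le> r"
  shows "finite {m. num_partitions (int n - int (tri r m)) \<noteq> 0}"
proof (rule finite_subset)
  show "{m. num_partitions (int n - int (tri r m)) \<noteq> 0} \<subseteq> {..n}"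
  proof
    fix m assume "m \<in> {m. num_partitions (int n - int (tri r m)) \<noteq> 0}"
    then have "tri r m \<le> n" by (auto simp: num_partitions_def split: if_splits)
    moreover have "m \<le> m * (m + 1) div 2" by (induction m) auto
    moreover have "m * (m + 1) div 2 \<le> tri r m"
      using assms by (simp add: tri_def)
    ultimately show "m \<in> {..n}" by simp
  qed
qed simp

end

(* The r-mex of a partition exceeds m iff the partition contains r copies of each of 1, ..., m.
   Removing these copies, whose sum is t_r(m), is a bijection onto the partitions of n - t_r(m).
   So p(n - t_r(m)) counts the partitions with r-mex > m, and both identities are the summation
   by parts of f(r-mex) = sum over m < r-mex of (f(m+1) - f(m)). *)
theory Submission
  imports Defs
begin

definition rect_block :: "nat \<Rightarrow> nat \<Rightarrow> nat multiset" where
  "rect_block r m = repeat_mset r (mset_set {1..m})"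

lemma count_rect_block: "count (rect_block r m) i = (if 1 \<le> i \<and> i \<le> m then r else 0)"
  by (simp add: rect_block_def count_mset_set')

lemma sum_rect_block: "sum_mset (rect_block r m) = tri r m"
proof -
  have "sum_mset (repeat_mset r A) = r * sum_mset A" for A :: "nat multiset"
    by (induction r) (simp_all add: algebra_simps)
  moreover have "sum_mset (mset_set {1..m}) = (\<Sum>i=1..m. i)"
    by (simp add: sum_unfold_sum_mset)
  moreover have "(\<Sum>i=1..m. i) = m * (m + 1) div 2"
    by (induction m) auto
  ultimately show ?thesis by (simp add: rect_block_def tri_def)
qed

text \<open>Every positive value below the r-mex occurs at least r times, so the block fits.
  Conversely, if the r-mex were at most m, the block would force r copies of it into
  \<open>\<pi>\<close>.\<close>

lemma less_rmex_iff:
  assumes "1 \<le> r"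
  shows "m < rmex r \<pi> \<longleftrightarrow> rect_block r m \<subseteq># \<pi>"
proof
  assume "m < rmex r \<pi>"
  then show "rect_block r m \<subseteq># \<pi>"
    using rmex_properties(3)[OF assms, of _ \<pi>]
    by (auto simp: subseteq_mset_def count_rect_block)
next
  assume sub: "rect_block r m \<subseteq># \<pi>"
  show "m < rmex r \<pi>"
  proof (rule ccontr)
    assume "\<not> m < rmex r \<pi>"
    then have "count (rect_block r m) (rmex r \<pi>) = r"
      using rmex_properties(1)[OF assms, of \<pi>] by (simp add: count_rect_block)
    then show False
      using rmex_properties(2)[OF assms, of \<pi>] mset_subset_eq_count[OF sub, of "rmex r \<pi>"]
      by simp
  qed
qed

lemma card_partitions_rmex_greater:
  assumes "1 \<le> r"
  shows "card {\<pi> \<in> partitions n. m < rmex r \<pi>} = num_partitions (int n - int (tri r m))"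
proof (cases "tri r m \<le> n")
  case True
  have zero: "0 \<notin># rect_block r m"
    by (simp add: not_in_iff count_rect_block)
  \<comment> \<open>Multiset subtraction is truncated, so adding the block back recovers
    \<open>\<pi>\<close> only if \<open>\<pi>\<close> contains the block; by
    \<open>less_rmex_iff\<close> this holds throughout the target set.\<close>
  have "bij_betw (\<lambda>\<pi>. \<pi> + rect_block r m) (partitions (n - tri r m))
          {\<pi> \<in> partitions n. m < rmex r \<pi>}"
    by (rule bij_betw_byWitness[where f' = "\<lambda>\<pi>. \<pi> - rect_block r m"])
      (use True zero in \<open>auto simp: less_rmex_iff[OF assms] partitions_def sum_rect_block
        sum_mset_diff dest: in_diffD\<close>)
  then have "card (partitions (n - tri r m)) = card {\<pi> \<in> partitions n. m < rmex r \<pi>}"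
    by (rule bij_betw_same_card)
  then show ?thesis
    using True by (simp add: num_partitions_def flip: of_nat_diff)
next
  case False
  \<comment> \<open>The block alone already sums to more than n, so no partition of n contains it;
    this matches the value 0 of \<open>num_partitions\<close> at negative arguments.\<close>
  have "tri r m \<le> sum_mset \<pi>" if "rect_block r m \<subseteq># \<pi>" for \<pi>
  proof -
    have "sum_mset \<pi> = sum_mset (rect_block r m) + sum_mset (\<pi> - rect_block r m)"
      using that by (metis subset_mset.add_diff_inverse sum_mset.union)
    then show ?thesis by (simp add: sum_rect_block)
  qed
  with False have "{\<pi> \<in> partitions n. m < rmex r \<pi>} = {}"
    by (auto simp: less_rmex_iff[OF assms] partitions_def)
  then have "card {\<pi> \<in> partitions n. m < rmex r \<pi>} = 0"
    by (simp only: card.empty)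
  with False show ?thesis by (simp add: num_partitions_def)
qed

text \<open>Stated for arbitrary f so that plain and signed powers are both instances. The condition
  \<open>f 0 = 0\<close> removes the boundary term of the telescoping sum.\<close>

lemma sum_rmex_by_parts:
  fixes f :: "nat \<Rightarrow> int"
  assumes "1 \<le> r" and "f 0 = 0"
  shows "(\<Sum>\<pi>\<in>partitions n. f (rmex r \<pi>))
           = (\<Sum>m. (f (m + 1) - f m) * int (num_partitions (int n - int (tri r m))))"
proof -
  define p where "p m = num_partitions (int n - int (tri r m))" for m
  \<comment> \<open>A finite index set common to all partitions, so that the two sums can be
    exchanged.\<close>
  define M where "M = {m. p m \<noteq> 0}"
  have finM: "finite M"
    using finite_support_num_partitions[OF assms(1)] by (simp add: M_def p_def)
  have card_p: "card {\<pi> \<in> partitions n. m < rmex r \<pi>} = p m" for m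
    using card_partitions_rmex_greater[OF assms(1)] by (simp add: p_def)
  \<comment> \<open>The partition \<open>\<pi>\<close> is itself one of those counted by
    \<open>p m\<close>. Hence restricting m to \<open>M\<close> loses no term of any telescoping
    sum.\<close>
  have in_M: "m \<in> M" if "\<pi> \<in> partitions n" "m < rmex r \<pi>" for \<pi> m
  proof -
    have "card {\<pi> \<in> partitions n. m < rmex r \<pi>} \<noteq> 0"
      using that finite_partitions[of n] by (auto simp: card_eq_0_iff)
    then show ?thesis unfolding M_def card_p by simp
  qed
  have "(\<Sum>\<pi>\<in>partitions n. f (rmex r \<pi>))
      = (\<Sum>\<pi>\<in>partitions n. \<Sum>m\<in>M. if m < rmex r \<pi> then f (m + 1) - f m else 0)"
  proof (rule sum.cong[OF refl])
    fix \<pi> assume "\<pi> \<in> partitions n"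
    then have "M \<inter> {m. m < rmex r \<pi>} = {..<rmex r \<pi>}" using in_M by auto
    then show "f (rmex r \<pi>) = (\<Sum>m\<in>M. if m < rmex r \<pi> then f (m + 1) - f m else 0)"
      using sum_lessThan_telescope[of f "rmex r \<pi>"] assms(2) finM
      by (simp add: sum.If_cases)
  qed
  also have "\<dots> = (\<Sum>m\<in>M. \<Sum>\<pi>\<in>partitions n. if m < rmex r \<pi> then f (m + 1) - f m else 0)"
    by (rule sum.swap)
  also have "\<dots> = (\<Sum>m\<in>M. (f (m + 1) - f m) * int (p m))"
    \<comment> \<open>For fixed m the summand is constant on the partitions with r-mex above m and
      zero elsewhere, so the inner sum is that constant times their number.\<close>
    by (simp add: sum.If_cases finite_partitions Int_def mult.commute flip: card_p)
  also have "\<dots> = (\<Sum>m. (f (m + 1) - f m) * int (p m))"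
    by (rule Sum_any.expand_superset[OF finM, symmetric]) (auto simp: M_def)
  finally show ?thesis by (simp add: p_def)
qed

theorem theorem1p3:
  fixes k n r :: nat
  assumes "k \<ge> 1" and "n \<ge> 1" and "r \<ge> 1"
  shows "sigma_rmex k r n =
           (\<Sum>m. (int (m + 1) ^ k - int m ^ k)
                  * int (num_partitions (int n - int (tri r m))))
       \<and> sigma_bar_rmex k r n =
           (\<Sum>m. (- 1) ^ m * (int (m + 1) ^ k + int m ^ k)
                  * int (num_partitions (int n - int (tri r m))))"
proof
  show "sigma_rmex k r n =
           (\<Sum>m. (int (m + 1) ^ k - int m ^ k)
                  * int (num_partitions (int n - int (tri r m))))"
    \<comment> \<open>Here \<open>k \<ge> 1\<close> gives \<open>0 ^ k = 0\<close>.\<close>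
    using sum_rmex_by_parts[OF assms(3), of "\<lambda>m. int m ^ k" n] assms(1)
    by (simp add: sigma_rmex_def)
next
  \<comment> \<open>For positive m this is \<open>(- 1) ^ (m - 1) * int m ^ k\<close>, written
    without truncated subtraction. The alternating sign turns the difference of consecutive values
    into a signed sum of powers.\<close>
  define f where "f m = - ((- 1) ^ m * int m ^ k)" for m
  have "sigma_bar_rmex k r n = (\<Sum>\<pi>\<in>partitions n. f (rmex r \<pi>))"
    unfolding sigma_bar_rmex_def
  proof (rule sum.cong[OF refl])
    fix \<pi>
    obtain j where "rmex r \<pi> = Suc j"
      using rmex_properties(1)[OF assms(3), of \<pi>] gr0_implies_Suc by blast
    then show "(- 1) ^ (rmex r \<pi> - 1) * int (rmex r \<pi>) ^ k = f (rmex r \<pi>)"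
      by (simp add: f_def)
  qed
  also have "\<dots> = (\<Sum>m. (f (m + 1) - f m) * int (num_partitions (int n - int (tri r m))))"
    using assms(1) by (intro sum_rmex_by_parts[OF assms(3)]) (simp add: f_def)
  also have "(\<lambda>m. f (m + 1) - f m) = (\<lambda>m. (- 1) ^ m * (int (m + 1) ^ k + int m ^ k))"
    by (simp add: f_def algebra_simps)
  finally show "sigma_bar_rmex k r n =
           (\<Sum>m. (- 1) ^ m * (int (m + 1) ^ k + int m ^ k)
                  * int (num_partitions (int n - int (tri r m))))" .
qed

end
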